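(* $\mathbf{G}^{\mathrm{qp}}_\uparrow$ is the intersection of all finite-valued quantified propositional Gödel logics: $\mathbf{G}^{\mathrm{qp}}_\uparrow=\bigcap_{k\ge2}\mathbf{G}^{\mathrm{qp}}_k$.
   Context: Formulas are built from a countably infinite set $\mathrm{Var}$ of propositional variables and the constants $\bot,\top$ using $\land,\lor,\supset$, the unary connective $\circ$, and the propositional quantifiers $(\forall p)$, $(\exists p)$. Let $V\subseteq[0,1]$ contain $0,1$ and be closed under infima and suprema. A valuation is a map $v:\mathrm{Var}\to V$; $v[w/p]$ agrees with $v$ except that it maps $p$ to $w$. Valuations extend to formulas by $v(\bot)=0$, $v(\top)=1$, $v(A\land B)=\min(v(A),v(B))$, $v(A\lor B)=\max(v(A),v(B))$, $v(A\supset B)=1$ if $v(A)\le v(B)$ and $=v(B)$ otherwise, $v((\exists p)A)=\sup\{v[w/p](A):w\in V\}$, $v((\forall p)A)=\inf\{v[w/p](A):w\in V\}$, and $v(\circ A)=v((\forall p)((p\supset A)\lor p))$ with $p$ not free in $A$. A formula $A$ is a tautology over $V$ if $v(A)=1$ for every valuation $v$ into $V$. $\mathbf{G}^{\mathrm{qp}}_\uparrow$ is the set of tautologies over $V_\uparrow=\{1-1/n:n\ge1\}\cup\{1\}$, and for $k\ge2$, $\mathbf{G}^{\mathrm{qp}}_k$ is the set of tautologies over $V_k=\{1-1/i:i=1,\dots,k-1\}\cup\{1\}$. *)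

theory Defs
  imports "HOL-Analysis.Analysis"
begin

type_synonym var = nat

datatype fm =
    Atom var
  | Bot
  | Top
  | And fm fm
  | Or fm fm
  | Imp fm fm
  | Circ fm
  | Forall var fm
  | Exists var fm

primrec free_vars :: "fm \<Rightarrow> var set" where
  "free_vars (Atom p) = {p}"
| "free_vars Bot = {}"
| "free_vars Top = {}"
| "free_vars (And A B) = free_vars A \<union> free_vars B"
| "free_vars (Or A B) = free_vars A \<union> free_vars B"
| "free_vars (Imp A B) = free_vars A \<union> free_vars B"
| "free_vars (Circ A) = free_vars A"
| "free_vars (Forall p A) = free_vars A - {p}"
| "free_vars (Exists p A) = free_vars A - {p}"

definition fresh_var :: "fm \<Rightarrow> var" where
  "fresh_var A = (SOME p. p \<notin> free_vars A)"

definition goedel_imp :: "real \<Rightarrow> real \<Rightarrow> real" where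
  "goedel_imp a b = (if a \<le> b then 1 else b)"

text \<open>
  Suprema and infima are taken in the reals, so the quantifier clauses are
  meaningful only for truth value sets as in \<open>truth_value_set\<close> below.  The clause for
  \<open>Circ A\<close> is that of \<open>Forall p (Or (Imp (Atom p) A) (Atom p))\<close>, written out so that the
  recursion is structural; lemma \<open>eval_Circ\<close> shows that any \<open>p\<close> not free in \<open>A\<close> will do.
\<close>

primrec eval :: "real set \<Rightarrow> (var \<Rightarrow> real) \<Rightarrow> fm \<Rightarrow> real" where
  "eval V v (Atom p) = v p"
| "eval V v Bot = 0"
| "eval V v Top = 1"
| "eval V v (And A B) = min (eval V v A) (eval V v B)"
| "eval V v (Or A B) = max (eval V v A) (eval V v B)"
| "eval V v (Imp A B) = goedel_imp (eval V v A) (eval V v B)"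
| "eval V v (Circ A) =
     (INF w\<in>V. max (goedel_imp w (eval V (v(fresh_var A := w)) A)) w)"
| "eval V v (Forall p A) = (INF w\<in>V. eval V (v(p := w)) A)"
| "eval V v (Exists p A) = (SUP w\<in>V. eval V (v(p := w)) A)"

lemma finite_free_vars: "finite (free_vars A)"
  by (induction A) auto

lemma fresh_var_not_free: "fresh_var A \<notin> free_vars A"
  unfolding fresh_var_def
  by (rule someI_ex) (use finite_free_vars ex_new_if_finite infinite_UNIV_nat in blast)

lemma eval_cong:
  "(\<And>p. p \<in> free_vars A \<Longrightarrow> v p = v' p) \<Longrightarrow> eval V v A = eval V v' A"
proof (induction A arbitrary: v v')
  case (And A B)
  have "eval V v A = eval V v' A" "eval V v B = eval V v' B"
    using And by (metis UnCI free_vars.simps(4))+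
  then show ?case by simp
next
  case (Or A B)
  have "eval V v A = eval V v' A" "eval V v B = eval V v' B"
    using Or by (metis UnCI free_vars.simps(5))+
  then show ?case by simp
next
  case (Imp A B)
  have "eval V v A = eval V v' A" "eval V v B = eval V v' B"
    using Imp by (metis UnCI free_vars.simps(6))+
  then show ?case by simp
next
  case (Circ A)
  have "eval V (v(fresh_var A := w)) A = eval V (v'(fresh_var A := w)) A" for w
    by (rule Circ.IH) (use Circ.prems in auto)
  then show ?case by simp
next
  case (Forall p A)
  have "eval V (v(p := w)) A = eval V (v'(p := w)) A" for w
    by (rule Forall.IH) (use Forall.prems in auto)
  then show ?case by simp
next
  case (Exists p A)
  have "eval V (v(p := w)) A = eval V (v'(p := w)) A" for w
    by (rule Exists.IH) (use Exists.prems in auto)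
  then show ?case by simp
qed auto

lemma eval_Circ:
  assumes "p \<notin> free_vars A"
  shows "eval V v (Circ A) = eval V v (Forall p (Or (Imp (Atom p) A) (Atom p)))"
proof -
  have "eval V (v(fresh_var A := w)) A = eval V (v(p := w)) A" for w
    by (rule eval_cong) (use assms fresh_var_not_free in auto)
  then show ?thesis by simp
qed

text \<open>
  The infimum and supremum of the empty set in \<open>{0..1}\<close> are \<open>1\<close> and \<open>0\<close>, so only
  nonempty subsets need a closure condition.
\<close>

definition truth_value_set :: "real set \<Rightarrow> bool" where
  "truth_value_set V \<longleftrightarrow>
     V \<subseteq> {0..1} \<and> 0 \<in> V \<and> 1 \<in> V \<and>
     (\<forall>X. X \<subseteq> V \<and> X \<noteq> {} \<longrightarrow> Inf X \<in> V \<and> Sup X \<in> V)"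

definition valuation :: "real set \<Rightarrow> (var \<Rightarrow> real) \<Rightarrow> bool" where
  "valuation V v \<longleftrightarrow> (\<forall>p. v p \<in> V)"

definition tautology :: "real set \<Rightarrow> fm \<Rightarrow> bool" where
  "tautology V A \<longleftrightarrow> (\<forall>v. valuation V v \<longrightarrow> eval V v A = 1)"

definition V_up :: "real set" where
  "V_up = {1 - 1 / real n | n. n \<ge> 1} \<union> {1}"

definition V_fin :: "nat \<Rightarrow> real set" where
  "V_fin k = {1 - 1 / real i | i. i \<in> {1..k - 1}} \<union> {1}"

definition G_up :: "fm set" where
  "G_up = {A. tautology V_up A}"

definition G_fin :: "nat \<Rightarrow> fm set" where
  "G_fin k = {A. tautology (V_fin k) A}"

lemma eval_in_truth_value_set:
  assumes V: "truth_value_set V"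
  shows "valuation V v \<Longrightarrow> eval V v A \<in> V"
proof (induction A arbitrary: v)
  have zero: "0 \<in> V" and one: "1 \<in> V" using V unfolding truth_value_set_def by blast+
  have img: "Inf (f ` V) \<in> V" "Sup (f ` V) \<in> V" if "\<And>w. w \<in> V \<Longrightarrow> f w \<in> V" for f
  proof -
    have "f ` V \<subseteq> V" "f ` V \<noteq> {}" using that zero by blast+
    then show "Inf (f ` V) \<in> V" "Sup (f ` V) \<in> V"
      using V unfolding truth_value_set_def by blast+
  qed
  have imp: "goedel_imp a b \<in> V" if "b \<in> V" for a b
    using that one by (simp add: goedel_imp_def)
  have mx: "max a b \<in> V" if "a \<in> V" "b \<in> V" for a b :: real
    using that by (simp add: max_def)
  have upd: "valuation V (v(p := w))" if "valuation V v" "w \<in> V" for v p w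
    using that by (simp add: valuation_def)
  {
    case (Atom p)
    then show ?case by (simp add: valuation_def)
  next
    case Bot
    show ?case using zero by simp
  next
    case Top
    show ?case using one by simp
  next
    case (And A B)
    show ?case using And.IH(1)[OF And.prems] And.IH(2)[OF And.prems] by (simp add: min_def)
  next
    case (Or A B)
    show ?case using Or.IH(1)[OF Or.prems] Or.IH(2)[OF Or.prems] by (simp add: max_def)
  next
    case (Imp A B)
    show ?case using imp[OF Imp.IH(2)[OF Imp.prems]] by simp
  next
    case (Circ A)
    have "max (goedel_imp w (eval V (v(fresh_var A := w)) A)) w \<in> V" if "w \<in> V" for w
      by (intro mx imp Circ.IH upd Circ.prems that)
    then show ?case unfolding eval.simps by (rule img)
  next
    case (Forall p A)
    show ?case unfolding eval.simps by (rule img) (rule Forall.IH[OF upd[OF Forall.prems]])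
  next
    case (Exists p A)
    show ?case unfolding eval.simps by (rule img) (rule Exists.IH[OF upd[OF Exists.prems]])
  }
qed

lemma compact_truth_value_set:
  assumes "compact V" "V \<subseteq> {0..1}" "0 \<in> V" "1 \<in> V"
  shows "truth_value_set V"
proof -
  have "Inf X \<in> V \<and> Sup X \<in> V" if X: "X \<subseteq> V" "X \<noteq> {}" for X
  proof -
    have "X \<subseteq> {0..1}" using X assms by blast
    then have "bdd_below X" "bdd_above X"
      using bdd_below_mono[of "{0..1::real}"] bdd_above_mono[of "{0..1::real}"] by auto
    then show ?thesis
      using X assms(1) closed_subset_contains_Inf closed_subset_contains_Sup compact_imp_closed
      by metis
  qed
  then show ?thesis using assms by (auto simp: truth_value_set_def)
qed

lemma truth_value_set_V_up: "truth_value_set V_up"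
proof (rule compact_truth_value_set)
  have "(\<lambda>n. 1 - 1 / real (Suc n)) \<longlonglongrightarrow> 1 - 0"
    by (intro tendsto_intros LIMSEQ_Suc lim_1_over_n)
  then have "compact (insert 1 (range (\<lambda>n. 1 - 1 / real (Suc n))))"
    using compact_sequence_with_limit[of _ "1::real"] by simp
  moreover have "insert 1 (range (\<lambda>n. 1 - 1 / real (Suc n))) = V_up"
  proof -
    have "{1 - 1 / real n | n. n \<ge> 1} = range (\<lambda>n. 1 - 1 / real (Suc n))"
    proof (intro set_eqI iffI)
      fix x assume "x \<in> {1 - 1 / real n | n. n \<ge> 1}"
      then obtain n where "n \<ge> 1" "x = 1 - 1 / real n" by blast
      then have "x = 1 - 1 / real (Suc (n - 1))" by simp
      then show "x \<in> range (\<lambda>n. 1 - 1 / real (Suc n))" by (rule range_eqI)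
    next
      fix x assume "x \<in> range (\<lambda>n. 1 - 1 / real (Suc n))"
      then obtain n where "x = 1 - 1 / real (Suc n)" by blast
      then show "x \<in> {1 - 1 / real n | n. n \<ge> 1}"
        by (intro CollectI exI[of _ "Suc n"]) simp
    qed
    then show ?thesis unfolding V_up_def by blast
  qed
  ultimately show "compact V_up" by simp
qed (auto simp: V_up_def intro!: exI[of _ "1::nat"])

lemma truth_value_set_V_fin: "k \<ge> 2 \<Longrightarrow> truth_value_set (V_fin k)"
  by (rule compact_truth_value_set)
    (auto simp: V_fin_def intro!: finite_imp_compact exI[of _ "1::nat"])

end

theory Submission
  imports Defs
begin

text \<open>
  Collapsing all truth values above \<open>1 - 1 / (k - 1)\<close> to \<open>1\<close> maps \<open>V_up\<close> onto \<open>V_fin k\<close>. This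
  map is a homomorphism for the Goedel connectives, and it preserves arbitrary infima and suprema:
  infima in \<open>V_up\<close> are attained, and if a supremum exceeds the threshold, so does some
  member.  Since it is onto, it therefore commutes with the evaluation of quantified formulas.
  A value in \<open>V_up\<close> is \<open>1\<close> iff all its collapses are, and the collapse fixes \<open>V_fin k\<close>, so that
  every valuation into \<open>V_fin k\<close> is the collapse of one into \<open>V_up\<close>.
\<close>

text \<open>Induction on \<open>A\<close>, with the valuation left arbitrary. Monotonicity handles
  \<open>And\<close> and \<open>Or\<close> because the order is linear. The quantifiers range over
  \<open>V\<close> on one side and over \<open>W\<close> on the other, which is why \<open>h\<close>
  has to be onto.\<close>

lemma eval_homomorphism:
  assumes V: "truth_value_set V" and onto: "h ` V = W"
    and mono: "mono_on V h" and zero: "h 0 = 0" and one: "h 1 = 1"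
    and imp: "\<And>a b. a \<in> V \<Longrightarrow> b \<in> V \<Longrightarrow> h (goedel_imp a b) = goedel_imp (h a) (h b)"
    and INF: "\<And>X. X \<subseteq> V \<Longrightarrow> X \<noteq> {} \<Longrightarrow> h (Inf X) = Inf (h ` X)"
    and SUP: "\<And>X. X \<subseteq> V \<Longrightarrow> X \<noteq> {} \<Longrightarrow> h (Sup X) = Sup (h ` X)"
  shows "valuation V v \<Longrightarrow> h (eval V v A) = eval W (h \<circ> v) A"
proof (induction A arbitrary: v)
  have nonempty: "V \<noteq> {}" and one_in: "1 \<in> V"
    using V unfolding truth_value_set_def by blast+
  have h_min: "h (min a b) = min (h a) (h b)" and h_max: "h (max a b) = max (h a) (h b)"
    if "a \<in> V" "b \<in> V" for a b
    using mono_onD[OF mono that] mono_onD[OF mono that(2,1)] by (auto simp: min_def max_def)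
  have h_INF: "h (INF w\<in>V. f w) = (INF w\<in>W. g w)"
    and h_SUP: "h (SUP w\<in>V. f w) = (SUP w\<in>W. g w)"
    if "\<And>w. w \<in> V \<Longrightarrow> f w \<in> V" "\<And>w. w \<in> V \<Longrightarrow> h (f w) = g (h w)" for f g
  proof -
    \<comment> \<open>Surjectivity enters here: each element of \<open>W\<close> is some
      \<open>h w\<close>, so both sides are the set of all \<open>g (h w)\<close> with
      \<open>w\<close> in \<open>V\<close>.\<close>
    have "h ` f ` V = g ` W"
      unfolding onto[symmetric] image_image using that(2) by (rule image_cong[OF refl])
    moreover have "f ` V \<subseteq> V" "f ` V \<noteq> {}" using that(1) nonempty by auto
    ultimately show "h (INF w\<in>V. f w) = (INF w\<in>W. g w)" "h (SUP w\<in>V. f w) = (SUP w\<in>W. g w)"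
      using INF[of "f ` V"] SUP[of "f ` V"] by simp_all
  qed
  have upd: "valuation V (v(p := w))" if "valuation V v" "w \<in> V" for v p w
    using that by (simp add: valuation_def)
  have in_V: "eval V v B \<in> V" if "valuation V v" for v B
    by (rule eval_in_truth_value_set[OF V that])
  have upd_IH: "h (eval V (v(p := w)) B) = eval W ((h \<circ> v)(p := h w)) B"
    if "\<And>v. valuation V v \<Longrightarrow> h (eval V v B) = eval W (h \<circ> v) B" "valuation V v" "w \<in> V"
    for v p w B
    using that(1)[OF upd[OF that(2,3)]] by (simp add: fun_upd_comp)
  {
    case (And A B)
    show ?case
      using h_min[OF in_V[OF And.prems, of A] in_V[OF And.prems, of B]]
        And.IH(1)[OF And.prems] And.IH(2)[OF And.prems] by simp
  next
    case (Or A B)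
    show ?case
      using h_max[OF in_V[OF Or.prems, of A] in_V[OF Or.prems, of B]]
        Or.IH(1)[OF Or.prems] Or.IH(2)[OF Or.prems] by simp
  next
    case (Imp A B)
    show ?case
      using imp[OF in_V[OF Imp.prems, of A] in_V[OF Imp.prems, of B]]
        Imp.IH(1)[OF Imp.prems] Imp.IH(2)[OF Imp.prems] by simp
  next
    case (Circ A)
    have goedel_imp_in: "goedel_imp w (eval V (v(fresh_var A := w)) A) \<in> V" if "w \<in> V" for w
      using in_V[OF upd[OF Circ.prems that]] one_in by (simp add: goedel_imp_def)
    show ?case unfolding eval.simps
    proof (rule h_INF)
      fix w assume w: "w \<in> V"
      show "max (goedel_imp w (eval V (v(fresh_var A := w)) A)) w \<in> V"
        using goedel_imp_in[OF w] w by (simp add: max_def)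
      show "h (max (goedel_imp w (eval V (v(fresh_var A := w)) A)) w) =
        max (goedel_imp (h w) (eval W ((h \<circ> v)(fresh_var A := h w)) A)) (h w)"
        using h_max[OF goedel_imp_in[OF w] w] imp[OF w in_V[OF upd[OF Circ.prems w]]]
          upd_IH[OF Circ.IH Circ.prems w] by simp
    qed
  next
    case (Forall p A)
    show ?case unfolding eval.simps
      by (rule h_INF) (rule in_V[OF upd[OF Forall.prems]] upd_IH[OF Forall.IH Forall.prems],
          assumption)+
  next
    case (Exists p A)
    show ?case unfolding eval.simps
      by (rule h_SUP) (rule in_V[OF upd[OF Exists.prems]] upd_IH[OF Exists.IH Exists.prems],
          assumption)+
  }
qed (simp_all add: zero one)

definition collapse :: "real \<Rightarrow> real \<Rightarrow> real" where
  "collapse c x = (if x \<le> c then x else 1)"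

text \<open>The critical case is \<open>c < b < a\<close>: the implication has value
  \<open>b\<close>, which collapses to \<open>1\<close>, and on the right both arguments have become
  \<open>1\<close>.\<close>

lemma collapse_goedel_imp:
  "a \<le> 1 \<Longrightarrow> b \<le> 1 \<Longrightarrow> collapse c (goedel_imp a b) = goedel_imp (collapse c a) (collapse c b)"
  by (auto simp: collapse_def goedel_imp_def)

lemma mono_on_collapse: "mono_on {..1} (collapse c)"
  by (auto simp: mono_on_def collapse_def)

lemma collapse_Sup:
  assumes "X \<subseteq> {..1}" "X \<noteq> {}"
  shows "collapse c (Sup X) = Sup (collapse c ` X)"
proof -
  have bdd: "bdd_above X" using assms(1) by (auto simp: bdd_above_def)
  show ?thesis
  proof (cases "Sup X \<le> c")
    case True
    then have "x \<le> c" if "x \<in> X" for x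
      using cSup_upper[OF that bdd] by simp
    then have "collapse c ` X = X" by (auto simp: collapse_def)
    then show ?thesis using True by (simp add: collapse_def)
  next
    case False
    then obtain x where x: "x \<in> X" "c < x"
      using less_cSup_iff[OF assms(2) bdd, of c] by auto
    have "Sup (collapse c ` X) = 1"
    proof (rule cSup_eq_maximum)
      show "1 \<in> collapse c ` X" using x by (force simp: collapse_def)
    qed (use assms(1) in \<open>auto simp: collapse_def\<close>)
    then show ?thesis using False by (simp add: collapse_def)
  qed
qed

text \<open>\<open>V_up\<close> is an increasing sequence with its limit on top, hence well-ordered:
  the least index occurring in \<open>X\<close> gives the minimum.\<close>

lemma V_up_has_minimum:
  assumes "X \<subseteq> V_up" "X \<noteq> {}"
  obtains m where "m \<in> X" "\<And>x. x \<in> X \<Longrightarrow> m \<le> x"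
proof (cases "X \<subseteq> {1}")
  case True
  then show ?thesis using assms(2) that[of 1] by blast
next
  case False
  \<comment> \<open>Since \<open>1 / 0 = 0\<close>, index \<open>0\<close> would denote the value
    \<open>1\<close>; the bound \<open>n \<ge> 1\<close> keeps it from being chosen as least
    index.\<close>
  let ?P = "\<lambda>n. n \<ge> 1 \<and> 1 - 1 / real n \<in> X"
  define n where "n = (LEAST n. ?P n)"
  have "\<exists>n. ?P n" using False assms(1) unfolding V_up_def by blast
  then have n: "?P n" unfolding n_def by (rule LeastI_ex)
  show ?thesis
  proof (rule that)
    show "1 - 1 / real n \<in> X" using n by blast
    fix x assume x: "x \<in> X"
    show "1 - 1 / real n \<le> x"
    proof (cases "x = 1")
      case False
      then obtain m where m: "m \<ge> 1" "x = 1 - 1 / real m"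
        using x assms(1) unfolding V_up_def by blast
      then have "n \<le> m" using x unfolding n_def by (intro Least_le) blast
      then show ?thesis using m n by (simp add: frac_le)
    qed simp
  qed
qed

text \<open>A monotone map sends a least element to a least element. Attainment is essential: a set
  of values above \<open>c\<close> with infimum \<open>c\<close> would collapse to
  \<open>{1}\<close>, while \<open>c\<close> itself is kept.\<close>

lemma collapse_Inf:
  assumes "X \<subseteq> V_up" "X \<noteq> {}"
  shows "collapse c (Inf X) = Inf (collapse c ` X)"
proof -
  obtain m where m: "m \<in> X" "\<And>x. x \<in> X \<Longrightarrow> m \<le> x"
    using V_up_has_minimum[OF assms] by blast
  have "X \<subseteq> {..1}"
    using assms(1) truth_value_set_V_up by (auto simp: truth_value_set_def)
  then have "Inf (collapse c ` X) = collapse c m"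
    using m by (intro cInf_eq_minimum) (auto intro: mono_onD[OF mono_on_collapse])
  then show ?thesis using cInf_eq_minimum[of m X] m by simp
qed

text \<open>For \<open>k \<ge> 2\<close> this is the largest element of \<open>V_fin k\<close> below
  \<open>1\<close>.\<close>

definition threshold :: "nat \<Rightarrow> real" where
  "threshold k = 1 - 1 / real (k - 1)"

lemma collapse_V_fin:
  assumes "x \<in> V_fin k"
  shows "collapse (threshold k) x = x"
  using assms by (auto simp: V_fin_def collapse_def threshold_def frac_le)

lemma V_fin_subset_V_up: "V_fin k \<subseteq> V_up"
  by (auto simp: V_fin_def V_up_def)

lemma collapse_onto_V_fin:
  assumes "k \<ge> 2"
  shows "collapse (threshold k) ` V_up = V_fin k"
proof
  show "collapse (threshold k) ` V_up \<subseteq> V_fin k"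
  proof
    fix y assume "y \<in> collapse (threshold k) ` V_up"
    then obtain x where x: "x \<in> V_up" "y = collapse (threshold k) x" by blast
    show "y \<in> V_fin k"
    proof (cases "x = 1 \<or> x > threshold k")
      case True
      then show ?thesis using x by (auto simp: collapse_def V_fin_def)
    next
      case False
      then obtain n where n: "n \<ge> 1" "x = 1 - 1 / real n" using x unfolding V_up_def by blast
      have "1 / real (k - 1) \<le> 1 / real n" using False n by (simp add: threshold_def)
      then have "n \<le> k - 1" using assms n by (simp add: divide_simps split: if_splits)
      then have "n \<in> {1..k - 1}" using n by simp
      then show ?thesis using False x n by (auto simp: collapse_def V_fin_def)
    qed
  qed
  show "V_fin k \<subseteq> collapse (threshold k) ` V_up"
    using V_fin_subset_V_up collapse_V_fin by (metis image_iff subset_iff)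
qed

lemma collapse_eval:
  assumes "k \<ge> 2" "valuation V_up v"
  shows "collapse (threshold k) (eval V_up v A) = eval (V_fin k) (collapse (threshold k) \<circ> v) A"
proof -
  have le_one: "V_up \<subseteq> {..1}"
    using truth_value_set_V_up by (auto simp: truth_value_set_def)
  \<comment> \<open>This guarantees that the collapse fixes \<open>0\<close>, as the clause for
    \<open>Bot\<close> demands.\<close>
  have "threshold k \<ge> 0" using assms(1) by (simp add: threshold_def)
  then show ?thesis
    using le_one assms
    by (intro eval_homomorphism[OF truth_value_set_V_up collapse_onto_V_fin]
        mono_on_subset[OF mono_on_collapse] collapse_goedel_imp collapse_Inf collapse_Sup)
      (auto simp: collapse_def)
qed

theorem theorem26:
  shows "G_up = (\<Inter>k\<in>{2..}. G_fin k)"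
proof (intro equalityI subsetI INT_I)
  fix A k assume A: "A \<in> G_up" and "k \<in> {2::nat..}"
  then have k: "k \<ge> 2" by simp
  have "eval (V_fin k) v A = 1" if v: "valuation (V_fin k) v" for v
  proof -
    have v_up: "valuation V_up v"
      using v V_fin_subset_V_up by (auto simp: valuation_def)
    have "collapse (threshold k) \<circ> v = v"
      using v collapse_V_fin by (auto simp: valuation_def)
    then have "eval (V_fin k) v A = collapse (threshold k) (eval V_up v A)"
      using collapse_eval[OF k v_up] by simp
    also have "\<dots> = 1"
      using A v_up by (simp add: G_up_def tautology_def collapse_def)
    finally show ?thesis .
  qed
  then show "A \<in> G_fin k" by (simp add: G_fin_def tautology_def)
next
  fix A assume A: "A \<in> (\<Inter>k\<in>{2..}. G_fin k)"
  have "eval V_up v A = 1" if v: "valuation V_up v" for v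
  proof (rule ccontr)
    assume ne: "eval V_up v A \<noteq> 1"
    then obtain n where n: "n \<ge> 1" "eval V_up v A = 1 - 1 / real n"
      using eval_in_truth_value_set[OF truth_value_set_V_up v, of A] unfolding V_up_def by blast
    \<comment> \<open>With this choice \<open>threshold k\<close> is exactly the value of
      \<open>A\<close>, so the collapse keeps that value below \<open>1\<close>.\<close>
    define k where "k = n + 1"
    have k: "k \<ge> 2" using n by (simp add: k_def)
    have "valuation (V_fin k) (collapse (threshold k) \<circ> v)"
      using v collapse_onto_V_fin[OF k] by (auto simp: valuation_def)
    then have "collapse (threshold k) (eval V_up v A) = 1"
      using A k by (simp add: collapse_eval[OF k v] G_fin_def tautology_def)
    then show False
      using ne n by (simp add: collapse_def threshold_def k_def)
  qed
  then show "A \<in> G_up" by (simp add: G_up_def tautology_def)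
qed

end
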